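(* Let $G\in C^2(\mathbb{R}^N;\mathbb{R})$, let $\bar u\in\operatorname{crit}G$, and assume that there exists a desingularizing function $\varphi:[0,r_0)\to\mathbb{R}_+$ of $G$ at $\bar u$ on $B(\bar u,\eta)$ such that, for some $c>0$, $\varphi'(s)\ge\frac{c}{\sqrt s}$ for every $s\in(0,r_0)$. For $\lambda\ge0$ let $$\mathcal{E}_\lambda(u,v)=\tfrac12\|v\|^2+G(u)+\lambda\langle\nabla G(u),v\rangle,\quad(u,v)\in\mathbb{R}^N\times\mathbb{R}^N.$$ Then there exist $\lambda_1>0$, $\eta_1>0$ and $c_1>0$ such that $$\Big\|\nabla\Big(\varphi\circ\tfrac12\big|\mathcal{E}_\lambda(\cdot,\cdot)-\mathcal{E}_\lambda(\bar u,0)\big|\Big)(u,v)\Big\|\ge c_1$$ for every $\lambda\in[0,\lambda_1]$ and every $(u,v)\in B(\bar u,\eta_1)\times B(0,\eta_1)$ such that $\mathcal{E}_\lambda(u,v)\ne\mathcal{E}_\lambda(\bar u,0)$.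
   Context: $\operatorname{crit}G=\{\nabla G=0\}$; $B(\cdot,\cdot)$ denotes open Euclidean balls in $\mathbb{R}^N$. The displayed inequality includes the assertion that the composed function is well defined at the points considered. Desingularizing function: for a differentiable $G:\mathbb{R}^N\to\mathbb{R}$ and $\bar u\in\mathbb{R}^N$, a function $\varphi\in C([0,r_0);\mathbb{R}_+)$ ($r_0>0$) is a desingularizing function of $G$ at $\bar u$ on $B(\bar u,\eta)$ ($\eta>0$) if $\varphi(0)=0$, $\varphi$ is $C^1$ on $(0,r_0)$, concave, with $\varphi'>0$ on $(0,r_0)$; $|G(u)-G(\bar u)|<r_0$ for all $u\in B(\bar u,\eta)$; and $\|\nabla(\varphi\circ|G(\cdot)-G(\bar u)|)(u)\|\ge1$ for each $u\in B(\bar u,\eta)$ with $G(u)\ne G(\bar u)$. *)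

theory Defs
  imports "HOL-Analysis.Analysis"
begin

definition grad :: "('a::euclidean_space \<Rightarrow> real) \<Rightarrow> 'a \<Rightarrow> 'a" where
  "grad F x = (THE D. GDERIV F x :> D)"

text \<open>\<open>grad F x\<close> is unspecified where \<open>F\<close> is not differentiable, so differentiability is stated
  alongside it below.\<close>

lemma GDERIV_unique:
  fixes F :: "'a::euclidean_space \<Rightarrow> real"
  assumes "GDERIV F x :> D" "GDERIV F x :> E"
  shows "D = E"
proof -
  have "(\<lambda>h. h \<bullet> D) = (\<lambda>h. h \<bullet> E)"
    using assms unfolding gderiv_def by (rule has_derivative_unique)
  then have "\<forall>h. h \<bullet> D = h \<bullet> E"
    by (simp add: fun_eq_iff)
  then show ?thesis
    by (simp only: vector_eq_ldot)
qed

lemma grad_eq: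
  fixes F :: "'a::euclidean_space \<Rightarrow> real"
  assumes "GDERIV F x :> D"
  shows "grad F x = D"
  unfolding grad_def using assms by (rule the_equality) (rule GDERIV_unique[OF _ assms])

lemma GDERIV_grad:
  fixes F :: "'a::euclidean_space \<Rightarrow> real"
  assumes "F differentiable (at x)"
  shows "GDERIV F x :> grad F x"
proof -
  obtain F' where F': "(F has_derivative F') (at x)"
    using assms unfolding differentiable_def by blast
  then have "linear F'"
    by (rule has_derivative_linear)
  then have "F' h = h \<bullet> adjoint F' 1" for h
    by (simp add: adjoint_works)
  then have "F' = (\<lambda>h. h \<bullet> adjoint F' 1)"
    by (rule ext)
  then have "GDERIV F x :> adjoint F' 1"
    using F' unfolding gderiv_def by simp
  then show ?thesis
    by (simp only: grad_eq)
qed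

text \<open>The gradient exists everywhere and has a Frechet derivative (the Hessian) that is continuous
  for the operator norm.\<close>

definition C2 :: "('a::euclidean_space \<Rightarrow> real) \<Rightarrow> bool" where
  "C2 F \<longleftrightarrow> (\<exists>g. \<exists>H :: 'a \<Rightarrow> 'a \<Rightarrow>\<^sub>L 'a.
     (\<forall>x. GDERIV F x :> g x) \<and>
     (\<forall>x. (g has_derivative blinfun_apply (H x)) (at x)) \<and>
     continuous_on UNIV H)"

definition crit :: "('a::euclidean_space \<Rightarrow> real) \<Rightarrow> 'a set" where
  "crit F = {u. F differentiable (at u) \<and> grad F u = 0}"

text \<open>A desingularizing function lives on \<open>[0, r0)\<close>; here it is a total function of which only the
  values on \<open>{0..<r0}\<close> matter. The composition \<open>\<phi> \<circ> \<bar>G(\<cdot>) - G(ubar)\<bar>\<close> is evaluated, near any point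
  where its gradient is taken, only at arguments in \<open>{0<..<r0}\<close>.\<close>

definition desingularizing ::
  "('a::euclidean_space \<Rightarrow> real) \<Rightarrow> 'a \<Rightarrow> real \<Rightarrow> real \<Rightarrow> (real \<Rightarrow> real) \<Rightarrow> bool" where
  "desingularizing G ubar \<eta> r0 \<phi> \<longleftrightarrow>
     0 < \<eta> \<and> 0 < r0 \<and>
     (\<forall>u. G differentiable (at u)) \<and>
     continuous_on {0..<r0} \<phi> \<and>
     (\<forall>s\<in>{0..<r0}. 0 \<le> \<phi> s) \<and>
     \<phi> 0 = 0 \<and>
     (\<forall>s\<in>{0<..<r0}. \<phi> differentiable (at s)) \<and>
     continuous_on {0<..<r0} (deriv \<phi>) \<and>
     concave_on {0..<r0} \<phi> \<and>
     (\<forall>s\<in>{0<..<r0}. 0 < deriv \<phi> s) \<and>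
     (\<forall>u\<in>ball ubar \<eta>. \<bar>G u - G ubar\<bar> < r0) \<and>
     (\<forall>u\<in>ball ubar \<eta>. G u \<noteq> G ubar \<longrightarrow>
        (\<lambda>w. \<phi> \<bar>G w - G ubar\<bar>) differentiable (at u) \<and>
        1 \<le> norm (grad (\<lambda>w. \<phi> \<bar>G w - G ubar\<bar>) u))"

definition energy :: "('a::euclidean_space \<Rightarrow> real) \<Rightarrow> real \<Rightarrow> 'a \<times> 'a \<Rightarrow> real" where
  "energy G lam = (\<lambda>(u, v). (norm v)\<^sup>2 / 2 + G u + lam * (grad G u \<bullet> v))"

end

(* Near the critical point the gradient of the perturbed energy dominates S = |grad G u| + |v|, while
  the energy gap is at most |G u - G ubar| + S^2/2. Since deriv \<phi> is nonincreasing, half of the gap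
  can be replaced by the larger of |G u - G ubar| and S^2/2. In the first case the desingularizing
  inequality for G applies; in the second one the bound deriv \<phi> s \<ge> c / sqrt s compensates S. *)
theory Submission
  imports Defs
begin

text \<open>The absolute value is differentiable away from 0, and \<open>F x \<noteq> 0\<close>
  keeps the chain rule there. The case \<open>k = 1\<close> serves the gap of \<open>G\<close>, the
  case \<open>k = 1/2\<close> the gap of the energy.\<close>

lemma GDERIV_compose_scaled_abs:
  fixes F :: "'a::euclidean_space \<Rightarrow> real"
  assumes F: "GDERIV F x :> D" and "F x \<noteq> 0" and "f differentiable (at (k * \<bar>F x\<bar>))"
  shows "GDERIV (\<lambda>w. f (k * \<bar>F w\<bar>)) x :> (deriv f (k * \<bar>F x\<bar>) * k * sgn (F x)) *\<^sub>R D"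
proof -
  have f: "(f has_field_derivative deriv f (k * \<bar>F x\<bar>)) (at (k * \<bar>F x\<bar>))"
    using assms(3) DERIV_deriv_iff_real_differentiable by blast
  have "((\<lambda>y. k * \<bar>y\<bar>) has_field_derivative k * sgn (F x)) (at (F x))"
    using GDERIV_norm[OF assms(2)]
    by (intro DERIV_cmult) (simp add: gderiv_def has_field_derivative_def mult.commute[of "sgn _"])
  from DERIV_chain2[OF f this]
  have "((\<lambda>y. f (k * \<bar>y\<bar>)) has_field_derivative deriv f (k * \<bar>F x\<bar>) * (k * sgn (F x))) (at (F x))" .
  from GDERIV_DERIV_compose[OF F this] show ?thesis by (simp add: mult.assoc)
qed

text \<open>A concave function lies below its tangents. Adding the tangent inequalities at
  \<open>x\<close> and at \<open>y\<close> and dividing by \<open>y - x\<close> gives the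
  claim.\<close>

lemma deriv_antimono_concave:
  fixes f :: "real \<Rightarrow> real"
  assumes "concave_on {a<..<b} f" and "\<And>x. x \<in> {a<..<b} \<Longrightarrow> f differentiable (at x)"
    and "a < x" "x \<le> y" "y < b"
  shows "deriv f y \<le> deriv f x"
proof (cases "x = y")
  case False
  have tangent: "f t \<le> f s + deriv f s * (t - s)" if "s \<in> {a<..<b}" "t \<in> {a<..<b}" for s t
  proof -
    have "(f has_field_derivative deriv f s) (at s)"
      using assms(2)[OF that(1)] DERIV_deriv_iff_real_differentiable by blast
    then have "((\<lambda>z. - f z) has_field_derivative - deriv f s) (at s within {a<..<b})"
      by (intro DERIV_minus) (rule has_field_derivative_at_within)
    from convex_on_imp_above_tangent[OF _ _ _ that(2) this]
    have "- f t - - f s \<ge> - deriv f s * (t - s)"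
      using assms(1) that(1) by (simp add: concave_on_def)
    then show ?thesis by simp
  qed
  have "f y \<le> f x + deriv f x * (y - x)" "f x \<le> f y + deriv f y * (x - y)"
    using tangent assms(3-5) by auto
  then have "0 \<le> (deriv f x - deriv f y) * (y - x)"
    by (simp add: algebra_simps)
  then show ?thesis
    using False assms(4) by (simp add: zero_le_mult_iff)
qed simp

text \<open>Pairing \<open>A ?w\<close> with \<open>v\<close> yields the square of
  \<open>norm ?w\<close>, so Cauchy-Schwarz and division by \<open>norm ?w\<close> suffice. This
  controls the Hessian term in the gradient of the energy.\<close>

lemma norm_adjoint_blinfun_le:
  fixes A :: "'a::euclidean_space \<Rightarrow>\<^sub>L 'a"
  shows "norm (adjoint A v) \<le> norm A * norm v"
proof -
  let ?w = "adjoint A v"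
  have lin: "linear A"
    by (simp add: blinfun.bounded_linear_right bounded_linear.linear)
  have "norm ?w * norm ?w = A ?w \<bullet> v"
    using adjoint_works[OF lin, of ?w v] by (simp add: inner_commute flip: power2_norm_eq_inner power2_eq_square)
  also have "\<dots> \<le> norm (A ?w) * norm v"
    by (rule norm_cauchy_schwarz)
  also have "\<dots> \<le> (norm A * norm ?w) * norm v"
    by (intro mult_right_mono norm_blinfun norm_ge_zero)
  finally have "norm ?w * norm ?w \<le> norm ?w * (norm A * norm v)"
    by (simp add: mult_ac)
  then show ?thesis
    by (cases "norm ?w = 0") (auto simp del: norm_eq_zero simp: mult_le_cancel_left)
qed

text \<open>The adjoint comes from varying \<open>u\<close> in the pairing of \<open>g u\<close>
  with \<open>v\<close>: the derivative \<open>H h \<bullet> v\<close> has to be rewritten as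
  \<open>h \<bullet> adjoint H v\<close>.\<close>

lemma GDERIV_energy:
  fixes G :: "'a::euclidean_space \<Rightarrow> real" and H :: "'a \<Rightarrow>\<^sub>L 'a"
  assumes G: "\<And>x. GDERIV G x :> g x" and g: "(g has_derivative H) (at u)"
  shows "GDERIV (energy G lam) (u, v) :> (g u + lam *\<^sub>R adjoint H v, v + lam *\<^sub>R g u)"
proof -
  have lin: "linear H"
    by (simp add: blinfun.bounded_linear_right bounded_linear.linear)
  have energy: "energy G lam = (\<lambda>p. (snd p \<bullet> snd p) / 2 + G (fst p) + lam * (g (fst p) \<bullet> snd p))"
    using grad_eq[OF G] by (auto simp: energy_def fun_eq_iff power2_norm_eq_inner)
  have fst: "(fst has_derivative fst) (at (u, v))" and snd: "(snd has_derivative snd) (at (u, v))"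
    by (auto intro!: derivative_eq_intros)
  have G': "((\<lambda>p. G (fst p)) has_derivative (\<lambda>h. fst h \<bullet> g u)) (at (u, v))"
    using has_derivative_compose[OF fst, of G "\<lambda>h. h \<bullet> g u"] G[of u] by (simp add: gderiv_def)
  have g': "((\<lambda>p. g (fst p)) has_derivative (\<lambda>h. H (fst h))) (at (u, v))"
    using has_derivative_compose[OF fst, of g H] g by simp
  have "(energy G lam has_derivative
      (\<lambda>h. (v \<bullet> snd h + snd h \<bullet> v) / 2 + fst h \<bullet> g u + lam * (g u \<bullet> snd h + H (fst h) \<bullet> v))) (at (u, v))"
    unfolding energy using G' g' snd
    by (auto intro!: derivative_eq_intros)
  also have "(\<lambda>h. (v \<bullet> snd h + snd h \<bullet> v) / 2 + fst h \<bullet> g u + lam * (g u \<bullet> snd h + H (fst h) \<bullet> v)) =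
      (\<lambda>h. h \<bullet> (g u + lam *\<^sub>R adjoint H v, v + lam *\<^sub>R g u))"
    by (auto simp: fun_eq_iff inner_prod_def inner_add_right adjoint_works[OF lin]
        inner_commute algebra_simps)
  finally show ?thesis
    unfolding gderiv_def .
qed

text \<open>The cross terms cost at most \<open>norm v / 2\<close> in the first component and
  \<open>norm a / 2\<close> in the second, so the norms of the components add up to at least half of
  \<open>norm a + norm v\<close>. The norm of the pair dominates each of them, hence their
  mean.\<close>

lemma norm_energy_gradient_ge:
  fixes a v w :: "'a::real_inner"
  assumes "0 \<le> lam" "1 \<le> M" "lam * M \<le> 1 / 2" "norm w \<le> M * norm v"
  shows "(norm a + norm v) / 4 \<le> norm (a + lam *\<^sub>R w, v + lam *\<^sub>R a)"
proof -
  have "lam \<le> 1 / 2"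
    using assms(1-3) mult_left_mono[of 1 M lam] by simp
  then have "lam * norm a \<le> norm a / 2"
    using mult_right_mono[of lam "1/2" "norm a"] by simp
  moreover have "lam * norm w \<le> norm v / 2"
    using mult_left_mono[OF assms(4,1)] mult_right_mono[OF assms(3), of "norm v"]
    by (simp add: mult.assoc)
  moreover have "norm a - lam * norm w \<le> norm (a + lam *\<^sub>R w)"
      "norm v - lam * norm a \<le> norm (v + lam *\<^sub>R a)"
    using norm_diff_ineq[of a "lam *\<^sub>R w"] norm_diff_ineq[of v "lam *\<^sub>R a"] assms(1) by simp_all
  moreover have "norm (a + lam *\<^sub>R w) \<le> norm (a + lam *\<^sub>R w, v + lam *\<^sub>R a)"
      "norm (v + lam *\<^sub>R a) \<le> norm (a + lam *\<^sub>R w, v + lam *\<^sub>R a)"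
    using norm_fst_le[of "a + lam *\<^sub>R w"] norm_snd_le[of "v + lam *\<^sub>R a"] by auto
  ultimately show ?thesis
    by argo
qed

text \<open>Expanding the square produces \<open>(norm v)\<^sup>2 / 2\<close> and the product of the
  norms, which bounds the coupling term by Cauchy-Schwarz and \<open>lam \<le> 1\<close>.\<close>

lemma energy_gap_le:
  fixes G :: "'a::euclidean_space \<Rightarrow> real"
  assumes "0 \<le> lam" "lam \<le> 1"
  shows "\<bar>energy G lam (u, v) - energy G lam (u0, 0)\<bar> \<le>
    \<bar>G u - G u0\<bar> + (norm (grad G u) + norm v)\<^sup>2 / 2"
proof -
  let ?a = "grad G u"
  have "\<bar>lam * (?a \<bullet> v)\<bar> \<le> norm ?a * norm v"
    using mult_mono[OF assms(2) Cauchy_Schwarz_ineq2[of ?a v]] assms(1) by (simp add: abs_mult)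
  moreover have "(norm ?a + norm v)\<^sup>2 / 2 = (norm ?a)\<^sup>2 / 2 + norm ?a * norm v + (norm v)\<^sup>2 / 2"
    by (simp add: power2_sum field_simps)
  moreover have "energy G lam (u, v) - energy G lam (u0, 0) =
      (G u - G u0) + (norm v)\<^sup>2 / 2 + lam * (?a \<bullet> v)"
    by (simp add: energy_def)
  moreover have "0 \<le> (norm ?a)\<^sup>2" "0 \<le> (norm v)\<^sup>2"
    by simp_all
  ultimately show ?thesis
    by linarith
qed

theorem proposition3p11:
  fixes G :: "real ^ 'n \<Rightarrow> real"
    and ubar :: "real ^ 'n"
    and \<phi> :: "real \<Rightarrow> real"
    and r0 \<eta> :: real
  assumes "C2 G"
    and "ubar \<in> crit G"
    and "desingularizing G ubar \<eta> r0 \<phi>"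
    and "\<exists>c>0. \<forall>s\<in>{0<..<r0}. deriv \<phi> s \<ge> c / sqrt s"
  shows "\<exists>lam1>0. \<exists>\<eta>1>0. \<exists>c1>0.
    \<forall>lam\<in>{0..lam1}. \<forall>u\<in>ball ubar \<eta>1. \<forall>v\<in>ball 0 \<eta>1.
      energy G lam (u, v) \<noteq> energy G lam (ubar, 0) \<longrightarrow>
        \<bar>energy G lam (u, v) - energy G lam (ubar, 0)\<bar> / 2 < r0 \<and>
        (\<lambda>p. \<phi> (\<bar>energy G lam p - energy G lam (ubar, 0)\<bar> / 2)) differentiable (at (u, v)) \<and>
        norm (grad (\<lambda>p. \<phi> (\<bar>energy G lam p - energy G lam (ubar, 0)\<bar> / 2)) (u, v)) \<ge> c1"
proof -
  obtain g H where G: "\<And>x. GDERIV G x :> g x"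
    and g: "\<And>x. (g has_derivative blinfun_apply (H x)) (at x)" and "continuous_on UNIV H"
    using assms(1) unfolding C2_def by blast
  have grad: "grad G x = g x" for x
    using grad_eq[OF G] .
  have g0: "g ubar = 0"
    using assms(2) grad by (simp add: crit_def)
  have "0 < \<eta>" "0 < r0"
    and \<phi>: "\<And>s. s \<in> {0<..<r0} \<Longrightarrow> \<phi> differentiable (at s)" "\<And>s. s \<in> {0<..<r0} \<Longrightarrow> 0 < deriv \<phi> s"
    and range: "\<And>u. u \<in> ball ubar \<eta> \<Longrightarrow> \<bar>G u - G ubar\<bar> < r0"
    and desing: "\<And>u. u \<in> ball ubar \<eta> \<Longrightarrow> G u \<noteq> G ubar \<Longrightarrow> 1 \<le> norm (grad (\<lambda>w. \<phi> \<bar>G w - G ubar\<bar>) u)"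
    and "concave_on {0..<r0} \<phi>"
    using assms(3) unfolding desingularizing_def by blast+
  have concave: "concave_on {0<..<r0} \<phi>"
    using \<open>concave_on {0..<r0} \<phi>\<close> unfolding concave_on_def by (rule convex_on_subset) auto
  obtain c where "0 < c" and c: "\<And>s. s \<in> {0<..<r0} \<Longrightarrow> c / sqrt s \<le> deriv \<phi> s"
    using assms(4) by blast
  \<comment> \<open>The added 1 leaves room for a strict bound on the Hessian near
    \<open>ubar\<close> and also ensures \<open>1 \<le> M\<close>.\<close>
  define M where "M = norm (H ubar) + 1"
  have "1 \<le> M"
    by (simp add: M_def)
  \<comment> \<open>The largest value for which \<open>lam * M \<le> 1/2\<close> holds on all of
    \<open>{0..lam1}\<close>.\<close>
  define lam1 where "lam1 = 1 / (2 * M)"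
  have "0 < lam1" "lam1 \<le> 1"
    using \<open>1 \<le> M\<close> by (auto simp: lam1_def)
  have "\<forall>\<^sub>F u in nhds ubar. norm (H u) < M"
    using \<open>continuous_on UNIV H\<close> unfolding continuous_on_eq_continuous_at[OF open_UNIV]
    by (intro order_tendstoD(2)[OF tendsto_norm]) (auto simp: M_def continuous_at tendsto_at_iff_tendsto_nhds)
  moreover have "(g \<longlongrightarrow> g ubar) (nhds ubar)"
    using has_derivative_continuous[OF g[of ubar]] by (simp add: continuous_at tendsto_at_iff_tendsto_nhds)
  then have "\<forall>\<^sub>F u in nhds ubar. norm (g u) < sqrt r0 / 2"
    using \<open>0 < r0\<close> g0 by (intro order_tendstoD(2)[OF tendsto_norm]) auto
  ultimately have "\<forall>\<^sub>F u in nhds ubar. norm (H u) < M \<and> norm (g u) < sqrt r0 / 2"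
    by (rule eventually_conj)
  then obtain d where "0 < d" and d: "\<And>u. dist u ubar < d \<Longrightarrow> norm (H u) < M \<and> norm (g u) < sqrt r0 / 2"
    unfolding eventually_nhds_metric by blast
  \<comment> \<open>Here \<open>\<eta>\<close> allows the desingularizing inequality and
    \<open>d\<close> bounds the Hessian and \<open>g u\<close>. Since \<open>norm (g u)\<close> and
    \<open>norm v\<close> both stay below \<open>sqrt r0 / 2\<close>, their sum \<open>S\<close>
    stays below \<open>sqrt r0\<close>.\<close>
  define \<eta>1 where "\<eta>1 = min \<eta> (min d (sqrt r0 / 2))"
  \<comment> \<open>The entries 1 and \<open>c\<close> are the lower bounds for
    \<open>deriv \<phi> s * S\<close> in the two cases below. The 8 collects 4 from
    \<open>S / 4 \<le> norm D\<close> and 2 from halving the gap.\<close>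
  define c1 where "c1 = min (1 / 8) (c / 8)"
  have "0 < \<eta>1" "0 < c1"
    using \<open>0 < \<eta>\<close> \<open>0 < d\<close> \<open>0 < r0\<close> \<open>0 < c\<close> by (auto simp: \<eta>1_def c1_def)
  have main: "\<bar>energy G lam (u, v) - energy G lam (ubar, 0)\<bar> / 2 < r0 \<and>
      (\<lambda>p. \<phi> (\<bar>energy G lam p - energy G lam (ubar, 0)\<bar> / 2)) differentiable (at (u, v)) \<and>
      norm (grad (\<lambda>p. \<phi> (\<bar>energy G lam p - energy G lam (ubar, 0)\<bar> / 2)) (u, v)) \<ge> c1"
    if lam: "lam \<in> {0..lam1}" and u: "u \<in> ball ubar \<eta>1" and v: "v \<in> ball 0 \<eta>1"
      and neq: "energy G lam (u, v) \<noteq> energy G lam (ubar, 0)" for lam u v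
  proof -
    define S where "S = norm (g u) + norm v"
    define E where "E = (\<lambda>p. energy G lam p - energy G lam (ubar, 0))"
    define s where "s = \<bar>E (u, v)\<bar> / 2"
    define D where "D = (g u + lam *\<^sub>R adjoint (H u) v, v + lam *\<^sub>R g u)"
    have u\<eta>: "u \<in> ball ubar \<eta>" and "norm (H u) < M" "norm (g u) < sqrt r0 / 2" "norm v < sqrt r0 / 2"
      using u v d[of u] by (auto simp: \<eta>1_def dist_commute)
    have "0 \<le> S" "S < sqrt r0"
      using \<open>norm (g u) < _\<close> \<open>norm v < _\<close> by (auto simp: S_def)
    then have "S\<^sup>2 < r0"
      using power_strict_mono[of S "sqrt r0" 2] \<open>0 < r0\<close> by simp
    have "\<bar>E (u, v)\<bar> \<le> \<bar>G u - G ubar\<bar> + S\<^sup>2 / 2"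
      using energy_gap_le[of lam G u v ubar] lam \<open>lam1 \<le> 1\<close> by (simp add: E_def S_def grad)
    \<comment> \<open>The factor 1/2 in the composition pays off here: the mean of two numbers is at
      most their maximum.\<close>
    then have s_le: "s \<le> max \<bar>G u - G ubar\<bar> (S\<^sup>2 / 2)"
      unfolding s_def by linarith
    have "s < r0"
      using s_le range[OF u\<eta>] \<open>S\<^sup>2 < r0\<close> \<open>0 < r0\<close> by linarith
    then have s: "s \<in> {0<..<r0}"
      using neq by (simp add: s_def E_def)
    have "GDERIV E (u, v) :> D"
      using GDERIV_diff[OF GDERIV_energy[OF G g] GDERIV_const] by (simp add: E_def D_def)
    from GDERIV_compose_scaled_abs[OF this, of \<phi> "1/2"]
    have gd: "GDERIV (\<lambda>p. \<phi> (\<bar>E p\<bar> / 2)) (u, v) :> (deriv \<phi> s * (1/2) * sgn (E (u, v))) *\<^sub>R D"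
      using \<phi>(1)[OF s] neq by (simp add: s_def E_def)
    have "norm (adjoint (H u) v) \<le> M * norm v"
      using norm_adjoint_blinfun_le[of "H u" v] \<open>norm (H u) < M\<close>
      by (meson less_imp_le mult_right_mono norm_ge_zero order_trans)
    moreover have "lam * M \<le> 1 / 2"
      using lam \<open>1 \<le> M\<close> by (auto simp: lam1_def field_simps)
    ultimately have "S / 4 \<le> norm D"
      using norm_energy_gradient_ge lam \<open>1 \<le> M\<close> by (auto simp: S_def D_def)
    have "8 * c1 \<le> deriv \<phi> s * S"
    proof (cases "S\<^sup>2 / 2 \<le> \<bar>G u - G ubar\<bar>")
      case True
      define t where "t = \<bar>G u - G ubar\<bar>"
      have "s \<le> t" "t < r0"
        using s_le True range[OF u\<eta>] by (auto simp: t_def)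
      \<comment> \<open>Positivity of \<open>s\<close> passes to \<open>t\<close>, so
        \<open>u\<close> is a point where the desingularizing inequality is available.\<close>
      then have "G u \<noteq> G ubar" "t \<in> {0<..<r0}"
        using s by (auto simp: t_def)
      have "GDERIV (\<lambda>w. G w - G ubar) u :> g u"
        using GDERIV_diff[OF G GDERIV_const] by simp
      from GDERIV_compose_scaled_abs[OF this, of \<phi> 1]
      have "grad (\<lambda>w. \<phi> \<bar>G w - G ubar\<bar>) u = (deriv \<phi> t * sgn (G u - G ubar)) *\<^sub>R g u"
        using \<phi>(1)[OF \<open>t \<in> _\<close>] \<open>G u \<noteq> G ubar\<close> by (intro grad_eq) (simp add: t_def)
      with desing[OF u\<eta> \<open>G u \<noteq> G ubar\<close>] have "1 \<le> deriv \<phi> t * norm (g u)"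
        using \<phi>(2)[OF \<open>t \<in> _\<close>] \<open>G u \<noteq> G ubar\<close> by (simp add: abs_mult abs_sgn_eq)
      \<comment> \<open>Moving from \<open>t\<close> down to \<open>s\<close> can only increase
        \<open>deriv \<phi>\<close>, and \<open>norm (g u)\<close> is one summand of
        \<open>S\<close>.\<close>
      also have "\<dots> \<le> deriv \<phi> s * S"
        using deriv_antimono_concave[OF concave \<phi>(1), of s t] \<phi>(2)[OF s] s \<open>s \<le> t\<close> \<open>t < r0\<close>
        by (intro mult_mono) (auto simp: S_def)
      finally show ?thesis
        by (simp add: c1_def)
    next
      case False
      then have "s \<le> S\<^sup>2"
        using s_le zero_le_power2[of S] by linarith
      then have "sqrt s \<le> S"
        using \<open>0 \<le> S\<close> by (simp add: real_le_lsqrt)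
      \<comment> \<open>The singularity of \<open>c / sqrt s\<close> at 0 exactly offsets a small
        \<open>S\<close>.\<close>
      then have "c \<le> c / sqrt s * S"
        using \<open>0 < c\<close> s by (simp add: field_simps)
      also have "\<dots> \<le> deriv \<phi> s * S"
        by (intro mult_right_mono c s \<open>0 \<le> S\<close>)
      finally show ?thesis
        by (simp add: c1_def)
    qed
    also have "\<dots> \<le> deriv \<phi> s * (4 * norm D)"
      using \<open>S / 4 \<le> norm D\<close> \<phi>(2)[OF s] by (intro mult_left_mono) auto
    finally have "c1 \<le> norm ((deriv \<phi> s * (1/2) * sgn (E (u, v))) *\<^sub>R D)"
      using \<phi>(2)[OF s] neq by (simp add: abs_mult abs_sgn_eq E_def mult.commute)
    then show ?thesis
      using s gd grad_eq[OF gd] unfolding E_def s_def gderiv_def differentiable_def by auto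
  qed
  show ?thesis
    using \<open>0 < lam1\<close> \<open>0 < \<eta>1\<close> \<open>0 < c1\<close> main
    by (intro exI[of _ lam1] exI[of _ \<eta>1] exI[of _ c1] conjI) auto
qed

end
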